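(* Let $0\le\varepsilon\le 1/4$, let $k\ge l$ be positive integers, and let $G$ be a graph on $n\ge k+\lfloor(l+1)/2\rfloor+150\sqrt{\varepsilon}\, k$ vertices with at least $(1-\varepsilon)\binom{n}{2}$ edges. Then $G\rightarrow (P_{k+1},P_{l+1})$. In particular, given $0\le \varepsilon<1/90000$, for every graph $G$ on $n$ vertices with at least $(1-\varepsilon)\binom{n}{2}$ edges, $G\rightarrow P_k$ where $k=(2/3-100\sqrt{\varepsilon})n$.
   Context: $P_m$ denotes the path on $m$ vertices. For graphs $G,F,H$, $G\rightarrow (F,H)$ means that for every colouring of the edges of $G$ with red and blue there is a red copy of $F$ or a blue copy of $H$; $G\rightarrow H$ means $G\rightarrow (H,H)$. Floor and ceiling signs are omitted where they do not matter (e.g. $k=(2/3-100\sqrt{\varepsilon})n$ is understood rounded to an integer). *)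

theory Defs
  imports Complex_Main "HOL-Library.Ramsey"
begin

type_synonym 'a graph = "'a set \<times> 'a set set"

abbreviation verts :: "'a graph \<Rightarrow> 'a set" where "verts G \<equiv> fst G"
abbreviation edges :: "'a graph \<Rightarrow> 'a set set" where "edges G \<equiv> snd G"

definition finite_graph :: "'a graph \<Rightarrow> bool" where
  "finite_graph G \<longleftrightarrow> finite (verts G) \<and> edges G \<subseteq> nsets (verts G) 2"

definition path_graph :: "nat \<Rightarrow> nat graph" where
  "path_graph m = ({..<m}, {{i, Suc i} | i. Suc i < m})"

text \<open>A copy is a subgraph that need not be induced.\<close>

definition contains_copy :: "'a graph \<Rightarrow> 'b graph \<Rightarrow> bool" where
  "contains_copy G F \<longleftrightarrow>
     (\<exists>f. inj_on f (verts F) \<and> f ` verts F \<subseteq> verts G \<and> (\<forall>e\<in>edges F. f ` e \<in> edges G))"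

datatype colour = Red | Blue

definition colour_class :: "'a graph \<Rightarrow> ('a set \<Rightarrow> colour) \<Rightarrow> colour \<Rightarrow> 'a graph" where
  "colour_class G c x = (verts G, {e \<in> edges G. c e = x})"

definition arrows2 :: "'a graph \<Rightarrow> 'b graph \<Rightarrow> 'c graph \<Rightarrow> bool" where
  "arrows2 G F H \<longleftrightarrow>
     (\<forall>c. contains_copy (colour_class G c Red) F \<or> contains_copy (colour_class G c Blue) H)"

definition arrows :: "'a graph \<Rightarrow> 'b graph \<Rightarrow> bool" where
  "arrows G H \<longleftrightarrow> arrows2 G H H"

end

theory Submission
  imports Defs
begin

text \<open>Deleting the few vertices that miss many neighbours leaves a graph in which every vertex misses
  at most \<open>d\<close> others, with \<open>28 * d\<close> vertices to spare. Let \<open>X\<close> be a longest red path, on \<open>K\<close>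
  vertices, and suppose that a longest blue path is no longer (otherwise swap the colours). A vertex
  outside \<open>X\<close> has no two consecutive red neighbours on \<open>X\<close> and none among its ends. A blue path
  alternating between the outside and \<open>X\<close> can therefore be grown greedily: of three outside vertices,
  the two ends of the path and a fresh one, two share a blue neighbour in any pair of consecutive
  unused vertices of \<open>X\<close>. If these are the two ends, the path closes to a cycle through the first
  vertex of \<open>X\<close>, which is blue to the fresh vertex.

  The missing edges make this fall short by about \<open>6 * d\<close> vertices. This is repaired by a blue path
  on \<open>6 * d\<close> vertices outside \<open>X\<close>, if there is one. If there is none, then almost every outside
  vertex starts an outside red path on \<open>6 * d + 1\<close> vertices, hence has no red neighbour among the
  first \<open>6 * d + 1\<close> vertices of \<open>X\<close>, and all of these (not only every other one) can be used.\<close>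

section \<open>Paths as vertex lists, and paths forced by many adjacent pairs\<close>

definition path_in :: "('a \<Rightarrow> 'a \<Rightarrow> bool) \<Rightarrow> 'a set \<Rightarrow> 'a list \<Rightarrow> bool" where
  "path_in R V zs \<longleftrightarrow> distinct zs \<and> set zs \<subseteq> V \<and> successively R zs"

lemma path_in_rev:
  assumes "path_in R V zs" "symp R"
  shows "path_in R V (rev zs)"
  using assms by (auto simp: path_in_def symp_def elim!: successively_mono)

lemma path_in_append:
  assumes "path_in R V xs" "path_in R V ys" "set xs \<inter> set ys = {}"
    and "xs \<noteq> [] \<Longrightarrow> ys \<noteq> [] \<Longrightarrow> R (last xs) (hd ys)"
  shows "path_in R V (xs @ ys)"
  using assms by (auto simp: path_in_def successively_append_iff)

lemma path_in_appendD:
  assumes "path_in R V (xs @ ys)"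
  shows "path_in R V xs" "path_in R V ys"
    "xs \<noteq> [] \<Longrightarrow> ys \<noteq> [] \<Longrightarrow> R (last xs) (hd ys)" "set xs \<inter> set ys = {}"
  using assms by (auto simp: path_in_def successively_append_iff)

lemma path_in_Cons:
  assumes "path_in R V zs" "x \<in> V" "x \<notin> set zs" "zs \<noteq> [] \<Longrightarrow> R x (hd zs)"
  shows "path_in R V (x # zs)"
  using assms by (auto simp: path_in_def successively_Cons)

lemma path_in_take: "path_in R V zs \<Longrightarrow> path_in R V (take n zs)"
  by (metis append_take_drop_id path_in_appendD(1))

lemma path_in_drop: "path_in R V zs \<Longrightarrow> path_in R V (drop n zs)"
  by (metis append_take_drop_id path_in_appendD(2))

lemma path_in_mono: "path_in R V zs \<Longrightarrow> V \<subseteq> W \<Longrightarrow> path_in R W zs"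
  by (auto simp: path_in_def)

lemma path_in_length:
  assumes "path_in R V zs" "finite V" shows "length zs \<le> card V"
  using assms by (metis card_mono distinct_card path_in_def)

lemma longest_path_exists:
  assumes "finite V" "V \<noteq> {}"
  obtains xs where "path_in R V xs" "xs \<noteq> []" "\<And>zs. path_in R V zs \<Longrightarrow> length zs \<le> length xs"
proof -
  obtain v where "v \<in> V" using assms by auto
  then have v: "path_in R V [v]" by (auto simp: path_in_def)
  have "\<forall>zs. path_in R V zs \<longrightarrow> length zs < Suc (card V)"
    using path_in_length assms(1) by fastforce
  from ex_has_greatest_nat[OF v this] obtain xs
    where xs: "path_in R V xs" "\<And>zs. path_in R V zs \<Longrightarrow> length zs \<le> length xs" by blast
  moreover have "xs \<noteq> []" using xs(2)[OF v] by auto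
  ultimately show thesis using that by blast
qed

text \<open>All neighbours of the head of a longest path lie on that path.\<close>

lemma min_degree_imp_path:
  assumes "finite V" "V \<noteq> {}" "symp R" and deg: "\<And>v. v \<in> V \<Longrightarrow> s \<le> card {w \<in> V - {v}. R v w}"
  shows "\<exists>zs. path_in R V zs \<and> length zs = Suc s"
proof -
  obtain zs where zs: "path_in R V zs" "zs \<noteq> []"
      and mx: "\<And>zs'. path_in R V zs' \<Longrightarrow> length zs' \<le> length zs"
    using longest_path_exists[OF assms(1,2)] by blast
  obtain a as where z: "zs = a # as" using zs by (cases zs) auto
  have "{w \<in> V - {a}. R a w} \<subseteq> set as"
  proof
    fix w assume w: "w \<in> {w \<in> V - {a}. R a w}"
    show "w \<in> set as"
    proof (rule ccontr)
      assume "w \<notin> set as"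
      then have "path_in R V (w # zs)" using w zs z \<open>symp R\<close>
        by (intro path_in_Cons) (auto simp: symp_def)
      then show False using mx by force
    qed
  qed
  then have "card {w \<in> V - {a}. R a w} \<le> length as"
    by (meson List.finite_set card_length card_mono dual_order.trans)
  moreover have "a \<in> V" using zs z by (auto simp: path_in_def)
  ultimately have "Suc s \<le> length zs" using deg[of a] z by auto
  then show ?thesis using path_in_take[OF zs(1), of "Suc s"] by (intro exI[of _ "take (Suc s) zs"]) auto
qed

text \<open>A weak form of the Erdos-Gallai bound. A vertex with at most \<open>q\<close> neighbours
  lies in at most \<open>2 * q\<close> ordered pairs, so deleting it preserves the hypothesis. Once
  no such vertex is left, \<open>min_degree_imp_path\<close> applies.\<close>

lemma many_pairs_imp_path:
  assumes "finite V" "symp R" "\<And>x. \<not> R x x"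
    and "card {(x, y) \<in> V \<times> V. R x y} > 2 * q * card V"
  shows "\<exists>zs. path_in R V zs \<and> length zs = q + 2"
  using assms(1,4)
proof (induction "card V" arbitrary: V)
  case 0
  then show ?case by auto
next
  case (Suc n)
  show ?case
  proof (cases "\<forall>v\<in>V. Suc q \<le> card {w \<in> V - {v}. R v w}")
    case True
    then show ?thesis using min_degree_imp_path[of V R "Suc q"] Suc assms(2) by fastforce
  next
    case False
    then obtain v where v: "v \<in> V" "card {w \<in> V - {v}. R v w} \<le> q" by force
    let ?N = "{w \<in> V - {v}. R v w}" and ?W = "V - {v}"
    have "{(x, y) \<in> V \<times> V. R x y} \<subseteq> {(x, y) \<in> ?W \<times> ?W. R x y} \<union> (Pair v ` ?N \<union> (\<lambda>w. (w, v)) ` ?N)"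
      using assms(2,3) by (auto simp: symp_def)
    moreover have finN: "finite ?N" using Suc by auto
    moreover have "finite {(x, y) \<in> ?W \<times> ?W. R x y}"
      by (rule finite_subset[of _ "?W \<times> ?W"]) (use Suc(3) in auto)
    ultimately have "card {(x, y) \<in> V \<times> V. R x y} \<le>
        card ({(x, y) \<in> ?W \<times> ?W. R x y} \<union> (Pair v ` ?N \<union> (\<lambda>w. (w, v)) ` ?N))"
      by (intro card_mono) auto
    also have "\<dots> \<le> card {(x, y) \<in> ?W \<times> ?W. R x y} + (card (Pair v ` ?N) + card ((\<lambda>w. (w, v)) ` ?N))"
      by (meson add_left_mono card_Un_le order_trans)
    also have "\<dots> \<le> card {(x, y) \<in> ?W \<times> ?W. R x y} + (q + q)"
      using v(2) card_image_le[OF finN, of "Pair v"] card_image_le[OF finN, of "\<lambda>w. (w, v)"] by linarith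
    finally have "card {(x, y) \<in> ?W \<times> ?W. R x y} > 2 * q * card ?W"
      using Suc(2,3,4) v(1) by (simp add: algebra_simps flip: Suc(2))
    then have "\<exists>zs. path_in R ?W zs \<and> length zs = q + 2"
      using Suc v(1) by (intro Suc(1)) auto
    then show ?thesis using path_in_mono by blast
  qed
qed

section \<open>Greedy growth of alternating blue paths\<close>

definition alt :: "('a \<Rightarrow> 'a \<Rightarrow> bool) \<Rightarrow> 'a set \<Rightarrow> 'a set \<Rightarrow> 'a \<Rightarrow> 'a \<Rightarrow> bool" where
  "alt B U X a b \<longleftrightarrow> B a b \<and> (a \<in> U \<and> b \<in> X \<or> a \<in> X \<and> b \<in> U)"

text \<open>This abstracts from the longest red path, so that different families of pairs on it can
  be used. A pair may be degenerate, \<open>p i = q i\<close>. The size of \<open>I\<close> measures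
  how much of \<open>X\<close> is available: every vertex used costs at most two indices.\<close>

locale pair_cover =
  fixes B :: "'a \<Rightarrow> 'a \<Rightarrow> bool" and U X :: "'a set" and I :: "nat set"
    and p q :: "nat \<Rightarrow> 'a" and e :: nat and x\<^sub>1 :: 'a
  assumes symB: "symp B" and disj: "U \<inter> X = {}" and finI: "finite I" and finX: "finite X"
    and pq: "\<And>i. i \<in> I \<Longrightarrow> p i \<in> X" "\<And>i. i \<in> I \<Longrightarrow> q i \<in> X"
    and two: "\<And>x. x \<in> X \<Longrightarrow> card {i \<in> I. p i = x \<or> q i = x} \<le> 2"
    and bad: "\<And>u. u \<in> U \<Longrightarrow> card {i \<in> I. \<not> B u (p i) \<and> \<not> B u (q i)} \<le> e"
    and x1: "x\<^sub>1 \<in> X" "\<And>u. u \<in> U \<Longrightarrow> B u x\<^sub>1"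
begin

abbreviation A where "A \<equiv> alt B U X"

lemma symA: "symp A"
  using symB by (auto simp: alt_def symp_def)

lemma A_UX: "u \<in> U \<Longrightarrow> x \<in> X \<Longrightarrow> B u x \<Longrightarrow> A u x \<and> A x u"
  using symA by (auto simp: alt_def symp_def)

text \<open>A union bound: each vertex of \<open>Z \<inter> X\<close> spoils at most two indices,
  and each \<open>u\<close> in \<open>F\<close> at most \<open>e\<close>.\<close>

lemma free_pair:
  assumes "F \<subseteq> U" "finite F" "card I > 2 * card (Z \<inter> X) + card F * e"
  obtains i where "i \<in> I" "p i \<in> X - Z" "q i \<in> X - Z" "\<And>u. u \<in> F \<Longrightarrow> B u (p i) \<or> B u (q i)"
proof -
  let ?C = "\<Union>x\<in>Z \<inter> X. {i \<in> I. p i = x \<or> q i = x}"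
  let ?D = "\<Union>u\<in>F. {i \<in> I. \<not> B u (p i) \<and> \<not> B u (q i)}"
  have "card ?C \<le> (\<Sum>x\<in>Z \<inter> X. card {i \<in> I. p i = x \<or> q i = x})"
    using finX by (intro card_UN_le) auto
  also have "\<dots> \<le> (\<Sum>x\<in>Z \<inter> X. 2)" using two by (intro sum_mono) auto
  finally have C: "card ?C \<le> 2 * card (Z \<inter> X)" by simp
  have "card ?D \<le> (\<Sum>u\<in>F. card {i \<in> I. \<not> B u (p i) \<and> \<not> B u (q i)})"
    using assms by (intro card_UN_le) auto
  also have "\<dots> \<le> (\<Sum>u\<in>F. e)" using bad assms(1) by (intro sum_mono) auto
  finally have D: "card ?D \<le> card F * e" by simp
  have "card (?C \<union> ?D) < card I" using C D assms(3) card_Un_le[of ?C ?D] by linarith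
  moreover have "finite (?C \<union> ?D)" by (rule finite_subset[OF _ finI]) auto
  ultimately have "\<not> I \<subseteq> ?C \<union> ?D" by (meson card_mono not_le)
  then obtain i where "i \<in> I" "i \<notin> ?C" "i \<notin> ?D" by blast
  then show thesis using pq that[of i] by auto
qed

lemma free_neighbour:
  assumes "u \<in> U" "card I > 2 * card (Z \<inter> X) + e"
  obtains x where "x \<in> X - Z" "B u x"
proof -
  have "{u} \<subseteq> U" "card I > 2 * card (Z \<inter> X) + card {u} * e" using assms by auto
  then obtain i where "p i \<in> X - Z" "q i \<in> X - Z" "B u (p i) \<or> B u (q i)"
    by (meson finite.intros free_pair singletonI)
  then show thesis using that by blast
qed

text \<open>The invariant of the greedy growth. It keeps \<open>x\<^sub>1\<close> on the path
  because \<open>x\<^sub>1\<close> is blue to all of \<open>U\<close>: a cycle through it can be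
  opened there and joined to any fresh vertex.\<close>

definition alt_path :: "nat \<Rightarrow> 'a list \<Rightarrow> bool" where
  "alt_path r zs \<longleftrightarrow> path_in A (U \<union> X) zs \<and> hd zs \<in> U \<and> last zs \<in> U \<and>
     length zs = Suc (2 * r) \<and> card (set zs \<inter> X) = r \<and> (r > 0 \<longrightarrow> x\<^sub>1 \<in> set zs)"

lemma alt_path_rev: "alt_path r zs \<Longrightarrow> alt_path r (rev zs)"
  by (auto simp: alt_path_def path_in_rev[OF _ symA] hd_rev last_rev)

lemma alt_path_single: "u \<in> U \<Longrightarrow> alt_path 0 [u]"
  using disj by (auto simp: alt_path_def path_in_def)

lemma alt_path_Cons:
  assumes "alt_path r zs" "y \<in> U - set zs" "x \<in> X - set zs" "B y x" "B (hd zs) x"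
    and "r = 0 \<Longrightarrow> x = x\<^sub>1"
  shows "alt_path (Suc r) (y # x # zs)"
proof -
  have "zs \<noteq> []" using assms(1) by (auto simp: alt_path_def)
  have 1: "path_in A (U \<union> X) (x # zs)"
    using assms A_UX[of "hd zs" x] by (intro path_in_Cons) (auto simp: alt_path_def)
  have "path_in A (U \<union> X) (y # x # zs)"
    using assms A_UX[of y x] disj by (intro path_in_Cons 1) auto
  moreover have "set (y # x # zs) \<inter> X = insert x (set zs \<inter> X)" using assms disj by auto
  ultimately show ?thesis using assms \<open>zs \<noteq> []\<close> by (auto simp: alt_path_def)
qed

text \<open>The fresh vertex \<open>y\<close> is prescribed and becomes the head, so that another
  blue path starting at \<open>y\<close> can be attached later. The term \<open>3 * e\<close> pays
  for \<open>y\<close> and the two ends of the path.\<close>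

lemma alt_path_extend:
  assumes zs: "alt_path r zs" and y: "y \<in> U - set zs" and I: "card I > 2 * r + 3 * e"
  shows "\<exists>ws x. alt_path (Suc r) ws \<and> hd ws = y \<and> set ws = insert y (insert x (set zs)) \<and> x \<in> X"
proof (cases "r = 0")
  case True
  then have "set zs \<inter> X = {}" using zs by (auto simp: alt_path_def card_eq_0_iff)
  then have "alt_path (Suc r) (y # x\<^sub>1 # zs)"
    using zs y x1 by (intro alt_path_Cons) (auto simp: alt_path_def)
  then show ?thesis using x1 by (intro exI[of _ "y # x\<^sub>1 # zs"] exI[of _ x\<^sub>1]) auto
next
  case False
  let ?a = "hd zs" and ?b = "last zs"
  have ab: "?a \<in> U" "?b \<in> U" using zs by (auto simp: alt_path_def)
  have "card {y, ?a, ?b} \<le> 3" by (simp add: card_insert_if)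
  then have "card {y, ?a, ?b} * e \<le> 3 * e" by (rule mult_right_mono) simp
  then have c: "card I > 2 * card (set zs \<inter> X) + card {y, ?a, ?b} * e"
    using I zs unfolding alt_path_def by linarith
  have "{y, ?a, ?b} \<subseteq> U" using ab y by auto
  then obtain i where i: "p i \<in> X - set zs" "q i \<in> X - set zs"
      and iB: "\<And>u. u \<in> {y, ?a, ?b} \<Longrightarrow> B u (p i) \<or> B u (q i)"
    using free_pair[OF _ _ c] by (metis finite.simps)
  obtain x where x: "x \<in> X - set zs"
      and share: "B y x \<and> B ?a x \<or> B y x \<and> B ?b x \<or> B ?a x \<and> B ?b x"
    using i iB[of y] iB[of ?a] iB[of ?b] by blast
  consider "B y x" "B ?a x" | "B y x" "B ?b x" | "B ?a x" "B ?b x" using share by blast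
  then show ?thesis
  proof cases
    case 1
    then have "alt_path (Suc r) (y # x # zs)"
      using zs y x False by (intro alt_path_Cons) auto
    then show ?thesis using x by (intro exI[of _ "y # x # zs"] exI[of _ x]) auto
  next
    case 2
    then have "alt_path (Suc r) (y # x # rev zs)"
      using zs y x False by (intro alt_path_Cons alt_path_rev) (auto simp: hd_rev)
    then show ?thesis using x by (intro exI[of _ "y # x # rev zs"] exI[of _ x]) auto
  next
    case 3
    txt \<open>The path closes up to a cycle through \<open>x\<^sub>1\<close>, which is cut there.\<close>
    have "x\<^sub>1 \<in> set zs" using zs False by (auto simp: alt_path_def)
    then obtain as bs where z: "zs = as @ x\<^sub>1 # bs" by (meson split_list)
    have ne: "as \<noteq> []" "bs \<noteq> []" using z ab x1 disj by (auto split: if_splits)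
    have P: "path_in A (U \<union> X) (as @ x\<^sub>1 # bs)" using zs z by (auto simp: alt_path_def)
    \<comment> \<open>After the cut the predecessor of \<open>x\<^sub>1\<close> becomes the new end;
      alternation puts it into \<open>U\<close>, as the invariant requires.\<close>
    then have "A (last as) x\<^sub>1" using path_in_appendD(3)[OF P] ne by auto
    then have la: "last as \<in> U" using x1 disj by (auto simp: alt_def)
    have Pas: "path_in A (U \<union> X) as" and Pbs: "path_in A (U \<union> X) (x\<^sub>1 # bs)"
      using path_in_appendD[OF P] by auto
    have dz: "distinct zs" "set zs \<subseteq> U \<union> X" using zs by (auto simp: alt_path_def path_in_def)
    have "path_in A (U \<union> X) (x # as)"
      using x z dz ne 3 ab A_UX[of ?a x] by (intro path_in_Cons Pas) auto
    then have "path_in A (U \<union> X) ((x\<^sub>1 # bs) @ x # as)"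
      using x z dz ne 3 ab A_UX[of ?b x] by (intro path_in_append Pbs) auto
    then have "path_in A (U \<union> X) (y # (x\<^sub>1 # bs) @ x # as)"
      using x y z x1 A_UX[of y x\<^sub>1] disj by (intro path_in_Cons) auto
    moreover have "set (y # (x\<^sub>1 # bs) @ x # as) \<inter> X = insert x (set zs \<inter> X)"
      using y x z disj by auto
    ultimately have "alt_path (Suc r) (y # (x\<^sub>1 # bs) @ x # as)"
      using zs z la ne y x False by (auto simp: alt_path_def)
    then show ?thesis using x z by (intro exI[of _ "y # (x\<^sub>1 # bs) @ x # as"] exI[of _ x]) auto
  qed
qed

text \<open>The set \<open>W\<close> allows some vertices of \<open>U\<close> to be reserved for
  another path. The \<open>+ 2\<close> is there because the last extension starts from a path with
  only \<open>r - 1\<close> vertices in \<open>X\<close>.\<close>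

lemma alt_path_exists:
  assumes "finite W" "W \<subseteq> U" "Suc r \<le> card W" "card I + 2 > 2 * r + 3 * e"
  shows "\<exists>zs. alt_path r zs \<and> set zs \<subseteq> W \<union> X"
  using assms(3,4)
proof (induction r)
  case 0
  then obtain u where "u \<in> W" by fastforce
  then show ?case using alt_path_single[of u] assms(2) by (intro exI[of _ "[u]"]) auto
next
  case (Suc r)
  then obtain zs where zs: "alt_path r zs" "set zs \<subseteq> W \<union> X" by auto
  have "length zs = card (set zs)" "length zs = Suc (2 * r)" "card (set zs \<inter> X) = r"
    using zs by (auto simp: alt_path_def path_in_def distinct_card)
  moreover have "card (set zs) = card (set zs \<inter> X) + card (set zs - X)"
    by (metis Diff_Diff_Int Diff_subset List.finite_set card_Diff_subset card_Int_Diff)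
  ultimately have "card (set zs - X) = Suc r" by simp
  then have "card (set zs - X) < card W" using Suc by simp
  then obtain y where "y \<in> W" "y \<notin> set zs - X"
    by (metis List.finite_set card_mono finite_Diff not_le subsetI)
  then have y: "y \<in> W" "y \<in> U - set zs" using assms(2) disj by auto
  obtain ws x where "alt_path (Suc r) ws" "set ws = insert y (insert x (set zs))" "x \<in> X"
    using alt_path_extend[OF zs(1) y(2)] Suc by auto
  then show ?case using y zs by (intro exI[of _ ws]) auto
qed

lemma alt_imp_path: "path_in A V zs \<Longrightarrow> path_in B V zs"
  by (auto simp: path_in_def alt_def elim: successively_mono)

text \<open>An alternating path with both ends in \<open>U\<close> can be prolonged into
  \<open>X\<close> at both ends. Hence \<open>L + 1\<close> vertices need only
  \<open>(L + 1) div 2\<close> of them in \<open>U\<close>, the source of this term in the final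
  bound.\<close>

lemma blue_path:
  assumes "finite U" "L \<ge> 1" "(L + 1) div 2 \<le> card U" "card I > L + 3 * e"
  shows "\<exists>zs. path_in B (U \<union> X) zs \<and> length zs = L + 1"
proof -
  \<comment> \<open>The alternating path has \<open>2 * r + 1\<close> vertices; the parity of
    \<open>L\<close> decides whether one or two vertices of \<open>X\<close> are added at its
    ends.\<close>
  define r where "r = (L + 1) div 2 - 1"
  have r: "L \<ge> 2 * r + 1" "L \<le> 2 * r + 2" using assms(2) unfolding r_def by linarith+
  have "Suc r \<le> card U" "card I + 2 > 2 * r + 3 * e" using r assms unfolding r_def by linarith+
  then obtain zs where zs: "alt_path r zs"
    using alt_path_exists[of U r] assms(1) by auto
  have ab: "hd zs \<in> U" "last zs \<in> U" "zs \<noteq> []" "path_in B (U \<union> X) zs" "length zs = Suc (2 * r)"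
     "card (set zs \<inter> X) = r"
    using zs alt_imp_path by (auto simp: alt_path_def)
  obtain x where x: "x \<in> X - set zs" "B (hd zs) x"
    by (rule free_neighbour[of "hd zs" "set zs"]) (use ab assms(4) r in linarith)+
  have xz: "path_in B (U \<union> X) (x # zs)"
    using x ab symB by (intro path_in_Cons) (auto simp: symp_def)
  show ?thesis
  proof (cases "L = 2 * r + 1")
    case True
    then show ?thesis using xz ab by (intro exI[of _ "x # zs"]) auto
  next
    case False
    have "set (x # zs) \<inter> X = insert x (set zs \<inter> X)" using x by auto
    then have "card (set (x # zs) \<inter> X) = Suc r" using x ab by simp
    then obtain x' where x': "x' \<in> X - set (x # zs)" "B (last zs) x'"
      using ab assms(4) r False by (auto intro: free_neighbour[of "last zs" "set (x # zs)"])
    have "path_in B (U \<union> X) ((x # zs) @ [x'])"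
      using x' ab by (intro path_in_append xz) (auto simp: path_in_def)
    then show ?thesis using ab False r by (intro exI[of _ "(x # zs) @ [x']"]) auto
  qed
qed

end

section \<open>Two colours with few missing pairs, and an indexing of pairs along a path\<close>

locale two_coloured =
  fixes R B :: "'a \<Rightarrow> 'a \<Rightarrow> bool" and V :: "'a set" and d :: nat
  assumes finV: "finite V" and symR: "symp R" and symB: "symp B"
    and irrefl: "\<And>x. \<not> R x x" "\<And>x. \<not> B x x"
    and missing: "\<And>v. v \<in> V \<Longrightarrow> card {w \<in> V - {v}. \<not> R v w \<and> \<not> B v w} \<le> d"
begin

text \<open>Double counting of ordered pairs: each vertex of \<open>W\<close> has at least
  \<open>card W - 1 - d\<close> coloured neighbours in \<open>W\<close>, while
  \<open>many_pairs_imp_path\<close> allows on average at most \<open>2 * q\<close> red and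
  \<open>2 * q'\<close> blue ones.\<close>

lemma small_of_no_paths:
  assumes "W \<subseteq> V" and "\<And>zs. path_in R W zs \<Longrightarrow> length zs \<le> q + 1"
    and "\<And>zs. path_in B W zs \<Longrightarrow> length zs \<le> q' + 1"
  shows "card W \<le> 1 + d + 2 * q + 2 * q'"
proof (rule ccontr)
  assume large: "\<not> ?thesis"
  have finW: "finite W" using assms(1) finV finite_subset by blast
  let ?E = "\<lambda>R. {(x, y) \<in> W \<times> W. R x y}"
  have E: "card (?E Q) \<le> 2 * q * card W"
    if Q: "symp Q" "\<And>x. \<not> Q x x" "\<And>zs. path_in Q W zs \<Longrightarrow> length zs \<le> q + 1" for Q q
  proof (rule ccontr)
    assume "\<not> ?thesis"
    then have "2 * q * card W < card (?E Q)" by simp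
    then obtain zs where "path_in Q W zs" "length zs = q + 2"
      using many_pairs_imp_path[OF finW Q(1,2)] by blast
    then show False using Q(3) by fastforce
  qed
  have "card (?E R) \<le> 2 * q * card W" using symR irrefl(1) assms(2) by (rule E)
  moreover have "card (?E B) \<le> 2 * q' * card W" using symB irrefl(2) assms(3) by (rule E)
  moreover have "card W * (card W - 1 - d) \<le> card (?E R \<union> ?E B)"
  proof -
    have "card W - 1 - d \<le> card {w \<in> W. R v w \<or> B v w}" if v: "v \<in> W" for v
    proof -
      have "W - {v} \<subseteq> {w \<in> W. R v w \<or> B v w} \<union> {w \<in> V - {v}. \<not> R v w \<and> \<not> B v w}"
        using assms(1) by auto
      then have "card (W - {v}) \<le> card ({w \<in> W. R v w \<or> B v w} \<union> {w \<in> V - {v}. \<not> R v w \<and> \<not> B v w})"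
        using finW finV by (intro card_mono) auto
      also have "\<dots> \<le> card {w \<in> W. R v w \<or> B v w} + card {w \<in> V - {v}. \<not> R v w \<and> \<not> B v w}"
        by (rule card_Un_le)
      finally show ?thesis using missing[of v] v assms(1) finW by fastforce
    qed
    then have "(\<Sum>v\<in>W. card W - 1 - d) \<le> (\<Sum>v\<in>W. card {w \<in> W. R v w \<or> B v w})"
      by (rule sum_mono)
    also have "\<dots> = card (SIGMA v:W. {w \<in> W. R v w \<or> B v w})" using finW by simp
    also have "(SIGMA v:W. {w \<in> W. R v w \<or> B v w}) = ?E R \<union> ?E B" by auto
    finally show ?thesis by simp
  qed
  ultimately have "card W * (card W - 1 - d) \<le> card W * (2 * q + 2 * q')"
    using card_Un_le[of "?E R" "?E B"] by (simp add: algebra_simps)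
  then show False using large by auto
qed

end

text \<open>The indices below \<open>2 * j - 1\<close> carry degenerate pairs: each of the first \<open>j - 1\<close> vertices
  twice and the \<open>j\<close>-th once. The remaining ones carry the consecutive pairs from there on,
  followed by the degenerate pair of the last vertex.\<close>

definition fst_of :: "nat \<Rightarrow> nat \<Rightarrow> nat" where
  "fst_of j i = (if i < 2 * j - 1 then i div 2 else i - j)"

definition snd_of :: "nat \<Rightarrow> nat \<Rightarrow> nat \<Rightarrow> nat" where
  "snd_of K j i = (if i < 2 * j - 1 then i div 2 else min (i - j + 1) (K - 1))"

lemma fst_snd_of_less:
  assumes "1 \<le> j" "j \<le> K" "i < K + j"
  shows "fst_of j i < K" "snd_of K j i < K"
  using assms by (auto simp: fst_of_def snd_of_def)

text \<open>This shows that every position \<open>t\<close> is used by at most two indices. Before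
  \<open>j - 1\<close> these are the two degenerate copies; at \<open>j - 1\<close> the single
  degenerate copy \<open>2 * j - 2\<close> is followed by the first consecutive pair; later
  \<open>t\<close> is the second entry of one pair and the first of the next.\<close>

lemma fst_snd_of_index:
  assumes j: "1 \<le> j" "j \<le> K" and i: "i < K + j" and t: "t < K" "fst_of j i = t \<or> snd_of K j i = t"
  shows "i \<in> (let a = (if t < j - 1 then 2 * t else t + j - 1) in {a, Suc a})"
proof (cases "i < 2 * j - 1")
  case True
  then have "i div 2 = t" using t(2) by (simp add: fst_of_def snd_of_def)
  then have "i = 2 * t \<or> i = 2 * t + 1" "t \<le> j - 1" using True by linarith+
  then show ?thesis using True j(1) by (cases "t < j - 1") (auto simp: Let_def)
next
  case False
  then have "i - j = t \<or> min (i - j + 1) (K - 1) = t"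
    using t(2) by (simp add: fst_of_def snd_of_def)
  then have "i = t + j - 1 \<or> i = t + j" "\<not> t < j - 1" using False j t(1) i by linarith+
  then show ?thesis using j by (auto simp: Let_def)
qed

section \<open>Blue paths built around a longest red path\<close>

locale longest_red_path = two_coloured +
  fixes xs :: "'a list"
  assumes xs: "path_in R V xs" "xs \<noteq> []"
    and longest: "\<And>zs. path_in R V zs \<Longrightarrow> length zs \<le> length xs"
begin

abbreviation "K \<equiv> length xs"

text \<open>Otherwise the first \<open>i\<close> vertices of \<open>xs\<close> could be replaced by
  the reverse of \<open>us\<close>, which has more than \<open>i\<close> vertices.\<close>

lemma not_red_initial:
  assumes us: "path_in R (V - set xs) us" "us \<noteq> []" and i: "i < length us" "i < K"
  shows "\<not> R (hd us) (xs ! i)"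
proof
  assume "R (hd us) (xs ! i)"
  then have "path_in R V (rev us @ drop i xs)"
    using us i xs(1) set_drop_subset[of i xs]
    by (intro path_in_append path_in_rev symR path_in_drop)
      (auto simp: last_rev hd_drop_conv_nth path_in_def)
  then show False using longest i by fastforce
qed

lemma not_red_last: "u \<in> V - set xs \<Longrightarrow> \<not> R u (last xs)"
proof
  assume "u \<in> V - set xs" "R u (last xs)"
  then have "path_in R V (xs @ [u])"
    using xs symR by (intro path_in_append) (auto simp: path_in_def symp_def)
  then show False using longest by fastforce
qed

text \<open>Otherwise \<open>u\<close> could be inserted between the two vertices.\<close>

lemma not_red_consecutive:
  assumes u: "u \<in> V - set xs" and i: "Suc i < K" and red: "R u (xs ! i)" "R u (xs ! Suc i)"
  shows False
proof -
  have 1: "path_in R V (u # drop (Suc i) xs)"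
    using u i red xs(1) set_drop_subset[of "Suc i" xs]
    by (intro path_in_Cons path_in_drop) (auto simp: hd_drop_conv_nth)
  have "set (take (Suc i) xs) \<inter> set (drop (Suc i) xs) = {}"
    using xs(1) by (metis append_take_drop_id path_in_appendD(4))
  moreover have "last (take (Suc i) xs) = xs ! i"
    using i by (simp add: take_Suc_conv_app_nth)
  ultimately have "path_in R V (take (Suc i) xs @ u # drop (Suc i) xs)"
    using u red symR set_take_subset[of "Suc i" xs] xs(1)
    by (intro path_in_append 1 path_in_take) (auto simp: symp_def)
  then show False using longest i by fastforce
qed

text \<open>A larger \<open>j\<close> asks for longer outside red paths and yields more pairs in
  return. No \<open>u\<close> is red to both entries of a pair, so a pair without a blue neighbour
  of \<open>u\<close> contains a vertex missing to \<open>u\<close>. At most \<open>d\<close>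
  vertices are missing, each in at most two pairs, which gives \<open>2 * d\<close>.\<close>

lemma pair_cover_longest_path:
  assumes j: "1 \<le> j" "j \<le> K" and U: "U \<subseteq> V - set xs"
    and adj: "\<And>u. u \<in> U \<Longrightarrow> R u (hd xs) \<or> B u (hd xs)"
    and red: "\<And>u. u \<in> U \<Longrightarrow> \<exists>us. path_in R (V - set xs) us \<and> length us = j \<and> hd us = u"
  shows "pair_cover B U (set xs) {..<K + j} (\<lambda>i. xs ! fst_of j i) (\<lambda>i. xs ! snd_of K j i) (2 * d) (hd xs)"
proof -
  have lt: "fst_of j i < K" "snd_of K j i < K" if "i < K + j" for i
    using fst_snd_of_less[OF j that] by auto
  have two: "card {i \<in> {..<K + j}. xs ! fst_of j i = x \<or> xs ! snd_of K j i = x} \<le> 2" if x: "x \<in> set xs" for x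
  proof -
    obtain t where t: "t < K" "x = xs ! t" using x by (metis in_set_conv_nth)
    define a where "a = (if t < j - 1 then 2 * t else t + j - 1)"
    have ix: "xs ! s = x \<Longrightarrow> s = t" if "s < K" for s
      using that t xs(1) by (auto simp: path_in_def nth_eq_iff_index_eq)
    have "{i \<in> {..<K + j}. xs ! fst_of j i = x \<or> xs ! snd_of K j i = x} \<subseteq> {a, Suc a}"
    proof
      fix i assume i: "i \<in> {i \<in> {..<K + j}. xs ! fst_of j i = x \<or> xs ! snd_of K j i = x}"
      then have "fst_of j i = t \<or> snd_of K j i = t" using ix lt[of i] by blast
      then show "i \<in> {a, Suc a}"
        using fst_snd_of_index[OF j _ t(1), of i] i by (simp add: a_def Let_def)
    qed
    then have "card {i \<in> {..<K + j}. xs ! fst_of j i = x \<or> xs ! snd_of K j i = x} \<le> card {a, Suc a}"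
      by (intro card_mono) auto
    then show ?thesis by simp
  qed
  have nred: "\<not> R u (xs ! i)" if "u \<in> U" "i < j" for u i
    using red[OF that(1)] not_red_initial that j by fastforce
  have bad: "card {i \<in> {..<K + j}. \<not> B u (xs ! fst_of j i) \<and> \<not> B u (xs ! snd_of K j i)} \<le> 2 * d"
    if u: "u \<in> U" for u
  proof -
    let ?N = "{w \<in> V - {u}. \<not> R u w \<and> \<not> B u w} \<inter> set xs"
    have uV: "u \<in> V - set xs" using u U by auto
    have inV: "xs ! t \<in> V - {u}" if "t < K" for t
      using that xs(1) uV by (auto simp: path_in_def)
    have "xs ! fst_of j i \<in> ?N \<or> xs ! snd_of K j i \<in> ?N"
      if i: "i < K + j" "\<not> B u (xs ! fst_of j i)" "\<not> B u (xs ! snd_of K j i)" for i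
    proof -
      have "\<not> (R u (xs ! fst_of j i) \<and> R u (xs ! snd_of K j i))"
      proof
        assume r: "R u (xs ! fst_of j i) \<and> R u (xs ! snd_of K j i)"
        \<comment> \<open>The degenerate pairs at the start of \<open>xs\<close>, the consecutive
          pairs, and the degenerate pair of the last vertex.\<close>
        consider "i < 2 * j - 1" | "2 * j - 1 \<le> i" "i < K + j - 1" | "i = K + j - 1"
          using i j by linarith
        then show False
        proof cases
          case 1
          then show False using r nred[OF u, of "i div 2"] by (simp add: fst_of_def)
        next
          case 2
          then have "fst_of j i = i - j" "snd_of K j i = Suc (i - j)" "Suc (i - j) < K"
            using j by (auto simp: fst_of_def snd_of_def)
          then show False using r not_red_consecutive[OF uV] by metis
        next
          case 3
          then have "fst_of j i = K - 1" using j by (auto simp: fst_of_def)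
          then show False using r not_red_last[OF uV] xs(2) by (simp add: last_conv_nth)
        qed
      qed
      then show ?thesis using i lt[of i] inV by auto
    qed
    then have "{i \<in> {..<K + j}. \<not> B u (xs ! fst_of j i) \<and> \<not> B u (xs ! snd_of K j i)} \<subseteq>
        (\<Union>x\<in>?N. {i \<in> {..<K + j}. xs ! fst_of j i = x \<or> xs ! snd_of K j i = x})"
      by blast
    then have "card {i \<in> {..<K + j}. \<not> B u (xs ! fst_of j i) \<and> \<not> B u (xs ! snd_of K j i)} \<le>
        card (\<Union>x\<in>?N. {i \<in> {..<K + j}. xs ! fst_of j i = x \<or> xs ! snd_of K j i = x})"
      by (intro card_mono) auto
    also have "\<dots> \<le> (\<Sum>x\<in>?N. card {i \<in> {..<K + j}. xs ! fst_of j i = x \<or> xs ! snd_of K j i = x})"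
      by (intro card_UN_le) auto
    also have "\<dots> \<le> (\<Sum>x\<in>?N. 2)" using two by (intro sum_mono) auto
    also have "\<dots> \<le> 2 * card {w \<in> V - {u}. \<not> R u w \<and> \<not> B u w}"
      using finV by (simp add: card_mono)
    finally show ?thesis using missing[of u] uV by auto
  qed
  show ?thesis
  proof
    show "B u (hd xs)" if "u \<in> U" for u
      using adj[OF that] nred[OF that, of 0] j xs(2) by (auto simp: hd_conv_nth)
  qed (use symB U lt two bad xs(2) in \<open>auto\<close>)
qed

text \<open>Of the \<open>28 * d\<close> spare vertices, \<open>d\<close> pay for those missing to
  \<open>hd xs\<close>, which has to be blue to all outside vertices used. The other
  \<open>27 * d\<close> pay for a reserved blue path or for the vertices outside \<open>S\<close>.
  As \<open>e = 2 * d\<close>, the shortfall to be repaired is \<open>3 * e = 6 * d\<close>.\<close>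

theorem blue_path_exists:
  assumes L: "1 \<le> L" "L \<le> K" and V: "card V \<ge> K + (L + 1) div 2 + 28 * d"
  shows "\<exists>zs. path_in B V zs \<and> length zs = L + 1"
proof -
  have xsV: "set xs \<subseteq> V" and cxs: "card (set xs) = K" using xs(1) by (auto simp: path_in_def distinct_card)
  define N where "N = {w \<in> V - {hd xs}. \<not> R (hd xs) w \<and> \<not> B (hd xs) w}"
  define U where "U = V - set xs - N"
  have hdV: "hd xs \<in> V" using xs xsV by auto
  have "card N \<le> d" unfolding N_def by (rule missing[OF hdV])
  moreover have "card U \<ge> card (V - set xs) - card N"
    unfolding U_def by (rule diff_card_le_card_Diff) (use finV in \<open>auto simp: N_def\<close>)
  moreover have "card (V - set xs) = card V - K" using xsV cxs by (simp add: card_Diff_subset)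
  ultimately have cU: "card U \<ge> (L + 1) div 2 + 27 * d" using V by linarith
  have U: "finite U" "U \<subseteq> V - set xs" using finV by (auto simp: U_def)
  have adj: "R u (hd xs) \<or> B u (hd xs)" if "u \<in> U" for u
    using that symR symB hdV xs(2) unfolding U_def N_def symp_def by fastforce
  define S where "S = {u \<in> U. \<exists>us. path_in R U us \<and> length us = 6 * d + 1 \<and> hd us = u}"
  show ?thesis
  \<comment> \<open>For \<open>d = 0\<close> the empty list would be such a path, but it has no head
    to attach to. That case goes to the second branch, where \<open>S = U\<close>.\<close>
  proof (cases "d > 0 \<and> (\<exists>ys. path_in B U ys \<and> length ys = 6 * d)")
    case True
    then obtain y ys where ys: "path_in B U (y # ys)" "length (y # ys) = 6 * d"
      by (metis length_greater_0_conv list.exhaust mult_pos_pos zero_less_numeral)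
    show ?thesis
    proof (cases "L + 1 \<le> 6 * d")
      case True
      then show ?thesis
        using path_in_mono[OF path_in_take[OF ys(1), of "L + 1"], of V] ys(2) U
        by (intro exI[of _ "take (L + 1) (y # ys)"]) auto
    next
      case False
      interpret pc: pair_cover B U "set xs" "{..<K + 1}" "\<lambda>i. xs ! fst_of 1 i" "\<lambda>i. xs ! snd_of K 1 i" "2 * d" "hd xs"
      proof (rule pair_cover_longest_path)
        show "\<exists>us. path_in R (V - set xs) us \<and> length us = 1 \<and> hd us = u" if "u \<in> U" for u
          using that U by (intro exI[of _ "[u]"]) (auto simp: path_in_def)
      qed (use L U adj in auto)
      \<comment> \<open>Since \<open>ys\<close> supplies the missing \<open>6 * d\<close> vertices,
        the alternating part can be shorter, and the \<open>K + 1\<close> pairs suffice: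
        \<open>2 * r + 6 * d \<le> L \<le> K\<close>.\<close>
      define r where "r = (L - 6 * d) div 2"
      have r: "2 * r + 6 * d \<le> L" "L \<le> 2 * r + 6 * d + 1" using False unfolding r_def by linarith+
      let ?W = "U - set (y # ys)"
      have "distinct (y # ys)" using ys(1) unfolding path_in_def by blast
      then have cys: "card (set (y # ys)) = 6 * d" using ys(2) distinct_card by metis
      have "card ?W \<ge> card U - card (set (y # ys))" by (rule diff_card_le_card_Diff) auto
      then have "Suc r \<le> card ?W" using cys cU r True by linarith
      then obtain zs where zs: "pc.alt_path r zs" "set zs \<subseteq> ?W \<union> set xs"
        using pc.alt_path_exists[of ?W r] U(1) r L by auto
      have yU: "y \<in> U - set zs" using ys(1) zs(2) U(2) by (auto simp: path_in_def)
      have "card {..<K + 1} > 2 * r + 3 * (2 * d)" using r L by simp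
      \<comment> \<open>The last extension makes \<open>y\<close> an end of the alternating path,
        where \<open>ys\<close> is attached.\<close>
      from pc.alt_path_extend[OF zs(1) yU this] obtain ws x where
        ws: "pc.alt_path (Suc r) ws" "hd ws = y" "set ws = insert y (insert x (set zs))" "x \<in> set xs"
        by blast
      have wsp: "path_in B V ws" "length ws = Suc (2 * Suc r)" "ws \<noteq> []"
        using ws(1) pc.alt_imp_path path_in_mono[of B "U \<union> set xs" ws V] U(2) xsV
        unfolding pc.alt_path_def by auto
      have ysp: "path_in B V ys" "y \<notin> set ys" "ys \<noteq> [] \<Longrightarrow> B y (hd ys)"
        using ys(1) U(2) by (auto simp: path_in_def successively_Cons)
      have "path_in B V (rev ws @ ys)"
      proof (intro path_in_append path_in_rev symB wsp ysp)
        show "set (rev ws) \<inter> set ys = {}"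
          using ws(3,4) zs(2) ysp(2) ys(1) U(2) by (auto simp: path_in_def)
        show "B (last (rev ws)) (hd ys)" if "ys \<noteq> []"
          using ysp(3)[OF that] ws(2) wsp(3) by (simp add: last_rev)
      qed
      \<comment> \<open>The two parts have \<open>2 * r + 3\<close> and \<open>6 * d - 1\<close>
        vertices, as \<open>y\<close> already belongs to \<open>ws\<close>.\<close>
      moreover have "length (rev ws @ ys) \<ge> L + 1" using wsp(2) ys(2) r by simp
      ultimately show ?thesis
        using path_in_take[of B V "rev ws @ ys" "L + 1"]
        by (intro exI[of _ "take (L + 1) (rev ws @ ys)"]) auto
    qed
  next
    case no_blue: False
    have "card (U - S) \<le> 27 * d"
    proof (cases "d = 0")
      case True
      then have "S = U" by (auto simp: S_def path_in_def intro!: exI[of _ "[_]"])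
      then show ?thesis by simp
    next
      case False
      \<comment> \<open>The start of a red path on \<open>6 * d + 1\<close> vertices would belong to
        \<open>S\<close>, so red paths in \<open>U - S\<close> have at most \<open>6 * d\<close>
        vertices. Blue ones have at most \<open>6 * d - 1\<close> by the case assumption.\<close>
      have "card (U - S) \<le> 1 + d + 2 * (6 * d - 1) + 2 * (6 * d - 2)"
      proof (rule small_of_no_paths)
        show "U - S \<subseteq> V" using U by auto
      next
        fix zs assume zs: "path_in R (U - S) zs"
        show "length zs \<le> 6 * d - 1 + 1"
        proof (rule ccontr)
          assume "\<not> ?thesis"
          then have l: "6 * d + 1 \<le> length zs" by auto
          then have "path_in R U (take (6 * d + 1) zs)" "length (take (6 * d + 1) zs) = 6 * d + 1"
              "hd (take (6 * d + 1) zs) = hd zs"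
            using path_in_take path_in_mono[OF zs, of U] by auto
          moreover have "hd zs \<in> U - S"
            using zs l hd_in_set[of zs] unfolding path_in_def by fastforce
          ultimately show False unfolding S_def by blast
        qed
      next
        fix zs assume zs: "path_in B (U - S) zs"
        show "length zs \<le> 6 * d - 2 + 1"
        proof (rule ccontr)
          assume "\<not> ?thesis"
          then have "path_in B U (take (6 * d) zs)" "length (take (6 * d) zs) = 6 * d"
            using path_in_take path_in_mono[OF zs, of U] by auto
          then show False using no_blue False by blast
        qed
      qed
      then show ?thesis using False by linarith
    qed
    moreover have "S \<subseteq> U" by (auto simp: S_def)
    ultimately have cS: "card S \<ge> (L + 1) div 2" "finite S"
      using cU U(1) card_Diff_subset[of S U] finite_subset[of S U] by auto
    then have "S \<noteq> {}" using L by auto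
    then obtain us where "path_in R U us" "length us = 6 * d + 1" by (auto simp: S_def)
    then have jK: "6 * d + 1 \<le> K" using longest[of us] path_in_mono[of R U us V] U(2) by auto
    \<comment> \<open>With \<open>j = 6 * d + 1\<close> there are \<open>K + 6 * d + 1\<close>
      indices, more than the \<open>L + 3 * e\<close> that must be exceeded.\<close>
    interpret pc: pair_cover B S "set xs" "{..<K + (6 * d + 1)}" "\<lambda>i. xs ! fst_of (6 * d + 1) i"
      "\<lambda>i. xs ! snd_of K (6 * d + 1) i" "2 * d" "hd xs"
    proof (rule pair_cover_longest_path)
      show "\<exists>us. path_in R (V - set xs) us \<and> length us = 6 * d + 1 \<and> hd us = u" if "u \<in> S" for u
        using that path_in_mono[OF _ U(2)] by (auto simp: S_def)
    qed (use jK U adj \<open>S \<subseteq> U\<close> in auto)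
    obtain zs where "path_in B (S \<union> set xs) zs" "length zs = L + 1"
      using pc.blue_path[OF cS(2) L(1) cS(1)] L by auto
    then show ?thesis using path_in_mono[of B "S \<union> set xs" zs V] U(2) \<open>S \<subseteq> U\<close> xsV by blast
  qed
qed

end

section \<open>Symmetry between the colours\<close>

lemma two_coloured_swap: "two_coloured R B V d \<Longrightarrow> two_coloured B R V d"
  unfolding two_coloured_def by (simp add: conj_commute)

text \<open>Take longest paths in both colours. Around the longer one,
  \<open>blue_path_exists\<close>, with the colours swapped if necessary, produces a path of the
  other colour that exceeds the longest by one vertex.\<close>

theorem min_degree_path_ramsey:
  assumes "two_coloured R B V d" "1 \<le> l" "l \<le> k" "card V \<ge> k + (l + 1) div 2 + 28 * d"
  shows "(\<exists>zs. path_in R V zs \<and> length zs = k + 1) \<or> (\<exists>zs. path_in B V zs \<and> length zs = l + 1)"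
proof (rule ccontr)
  assume neg: "\<not> ?thesis"
  have V: "finite V" "V \<noteq> {}" using assms by (auto simp: two_coloured_def)
  obtain xs where lx: "path_in R V xs" "xs \<noteq> []" "\<And>zs. path_in R V zs \<Longrightarrow> length zs \<le> length xs"
    using longest_path_exists[OF V, of R] by blast
  obtain ys where ly: "path_in B V ys" "ys \<noteq> []" "\<And>zs. path_in B V zs \<Longrightarrow> length zs \<le> length ys"
    using longest_path_exists[OF V, of B] by blast
  have k: "length xs \<le> k"
  proof (rule ccontr)
    assume "\<not> ?thesis"
    then have "length (take (k + 1) xs) = k + 1" by simp
    then show False using path_in_take[OF lx(1)] neg by blast
  qed
  have l: "length ys \<le> l"
  proof (rule ccontr)
    assume "\<not> ?thesis"
    then have "length (take (l + 1) ys) = l + 1" by simp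
    then show False using path_in_take[OF ly(1)] neg by blast
  qed
  have ge1: "1 \<le> length xs" "1 \<le> length ys" using lx ly by (simp_all add: Suc_leI)
  show False
  proof (cases "length ys \<le> length xs")
    case True
    interpret longest_red_path R B V d xs
      using assms(1) lx by (simp add: longest_red_path_def longest_red_path_axioms_def)
    have "card V \<ge> length xs + (length ys + 1) div 2 + 28 * d"
      using assms(4) k l div_le_mono[of "length ys + 1" "l + 1" 2] by linarith
    then obtain zs where "path_in B V zs" "length zs = length ys + 1"
      using blue_path_exists[OF ge1(2) True] by blast
    then show False using ly(3) by fastforce
  next
    case False
    interpret longest_red_path B R V d ys
      using two_coloured_swap[OF assms(1)] ly by (simp add: longest_red_path_def longest_red_path_axioms_def)
    \<comment> \<open>The exchange of colours is harmless because
      \<open>length xs < length ys \<le> l \<le> k\<close>.\<close>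
    have "card V \<ge> length ys + (length xs + 1) div 2 + 28 * d"
      using assms(3,4) k l False div_le_mono[of "length xs + 1" "l + 1" 2] by linarith
    then obtain zs where "path_in R V zs" "length zs = length xs + 1"
      using blue_path_exists[OF ge1(1)] False by auto
    then show False using lx(3) by fastforce
  qed
qed

section \<open>Copies of paths and edge counts in finite graphs\<close>

lemma contains_copy_path_graph:
  assumes "path_in R (verts G) zs" "length zs = m" "\<And>x y. R x y \<Longrightarrow> {x, y} \<in> edges G"
  shows "contains_copy G (path_graph m)"
  unfolding contains_copy_def
proof (intro exI conjI ballI)
  show "inj_on ((!) zs) (verts (path_graph m))"
    using assms by (auto simp: path_graph_def path_in_def inj_on_nth)
  show "(!) zs ` verts (path_graph m) \<subseteq> verts G"
    using assms by (auto simp: path_graph_def path_in_def)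
  fix e assume "e \<in> edges (path_graph m)"
  then obtain i where i: "e = {i, Suc i}" "Suc i < m" by (auto simp: path_graph_def)
  then have "R (zs ! i) (zs ! Suc i)"
    using assms(1,2) by (auto simp: path_in_def successively_conv_nth)
  then show "(!) zs ` e \<in> edges G" using i assms(3) by simp
qed

lemma finite_graph_edgeE:
  assumes "finite_graph G" "e \<in> edges G"
  obtains a b where "e = {a, b}" "a \<noteq> b" "a \<in> verts G" "b \<in> verts G"
proof -
  have "e \<subseteq> verts G" "card e = 2" using assms by (auto simp: finite_graph_def nsets_def)
  then show thesis using that by (metis card_2_iff insert_subset)
qed

lemma finite_edges: "finite_graph G \<Longrightarrow> finite (edges G)"
  unfolding finite_graph_def by (meson finite_imp_finite_nsets finite_subset)

lemma not_edge_self: "finite_graph G \<Longrightarrow> {x, x} \<notin> edges G"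
  by (auto simp: finite_graph_def nsets_def)

lemma card_adjacent_pairs:
  assumes G: "finite_graph G"
  shows "card {(x, y) \<in> verts G \<times> verts G. {x, y} \<in> edges G} = 2 * card (edges G)"
proof -
  have two: "card {(x, y). {x, y} = e} = 2" if e: "e \<in> edges G" for e
  proof -
    obtain a b where ab: "e = {a, b}" "a \<noteq> b" using finite_graph_edgeE[OF G e] by blast
    then have "{(x, y). {x, y} = e} = {(a, b), (b, a)}" by (auto simp: doubleton_eq_iff)
    then show ?thesis using ab by simp
  qed
  have "{(x, y) \<in> verts G \<times> verts G. {x, y} \<in> edges G} = (\<Union>e\<in>edges G. {(x, y). {x, y} = e})"
    using G by (auto simp: finite_graph_def nsets_def)
  also have "card \<dots> = (\<Sum>e\<in>edges G. card {(x, y). {x, y} = e})"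
  proof (rule card_UN_disjoint)
    show "\<forall>e\<in>edges G. finite {(x, y). {x, y} = e}"
      using two by (metis card.infinite zero_neq_numeral)
  qed (use finite_edges[OF G] in auto)
  also have "\<dots> = 2 * card (edges G)" using two by simp
  finally show ?thesis .
qed

lemma sum_missing_degrees:
  assumes G: "finite_graph G" and n: "card (verts G) = n"
  shows "(\<Sum>v\<in>verts G. card {w \<in> verts G - {v}. {v, w} \<notin> edges G}) + 2 * card (edges G) = n * (n - 1)"
proof -
  let ?V = "verts G"
  have fin: "finite ?V" using G by (simp add: finite_graph_def)
  have "(\<Sum>v\<in>?V. card {w \<in> ?V - {v}. {v, w} \<notin> edges G}) + (\<Sum>v\<in>?V. card {w \<in> ?V. {v, w} \<in> edges G})
      = (\<Sum>v\<in>?V. card {w \<in> ?V - {v}. {v, w} \<notin> edges G} + card {w \<in> ?V. {v, w} \<in> edges G})"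
    by (simp add: sum.distrib)
  also have "\<dots> = (\<Sum>v\<in>?V. n - 1)"
  proof (rule sum.cong)
    fix v assume v: "v \<in> ?V"
    have "{v} \<notin> edges G" using not_edge_self[OF G, of v] by simp
    then have "card (?V - {v}) = card ({w \<in> ?V - {v}. {v, w} \<notin> edges G} \<union> {w \<in> ?V. {v, w} \<in> edges G})"
      by (intro arg_cong[where f = card]) auto
    also have "\<dots> = card {w \<in> ?V - {v}. {v, w} \<notin> edges G} + card {w \<in> ?V. {v, w} \<in> edges G}"
      using fin by (intro card_Un_disjoint) auto
    finally show "card {w \<in> ?V - {v}. {v, w} \<notin> edges G} + card {w \<in> ?V. {v, w} \<in> edges G} = n - 1"
      using v fin n by simp
  qed simp
  finally have "(\<Sum>v\<in>?V. card {w \<in> ?V - {v}. {v, w} \<notin> edges G}) + (\<Sum>v\<in>?V. card {w \<in> ?V. {v, w} \<in> edges G})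
      = n * (n - 1)" using n by simp
  moreover have "(\<Sum>v\<in>?V. card {w \<in> ?V. {v, w} \<in> edges G}) = card (SIGMA v:?V. {w \<in> ?V. {v, w} \<in> edges G})"
    using fin by simp
  moreover have "(SIGMA v:?V. {w \<in> ?V. {v, w} \<in> edges G}) = {(x, y) \<in> ?V \<times> ?V. {x, y} \<in> edges G}" by auto
  ultimately show ?thesis using card_adjacent_pairs[OF G] by simp
qed

section \<open>Dense graphs\<close>

lemma real_choose_two: "real (n choose 2) = real n * (real n - 1) / 2"
proof -
  have "2 * (n choose 2) = n * (n - 1)" by (cases n) (simp_all add: choose_two)
  then have "2 * real (n choose 2) = real (n * (n - 1))" by (metis of_nat_mult of_nat_numeral)
  then show ?thesis by (cases n) (auto simp: algebra_simps)
qed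

text \<open>Deleting vertices with many missing neighbours costs a multiple of
  \<open>sqrt \<epsilon> * n\<close>, whereas the room to spare is given as a multiple of
  \<open>sqrt \<epsilon> * k\<close>. Hence \<open>n > 6 * k\<close> is treated apart; there the
  number of edges alone forces one of the paths.\<close>

lemma dense_arrows_paths:
  fixes G :: "'a graph"
  assumes eps: "0 \<le> \<epsilon>" "\<epsilon> \<le> 1/4" and kl: "0 < l" "l \<le> k" and G: "finite_graph G"
    and n: "card (verts G) = n"
    and large: "real n \<ge> real k + real ((l + 1) div 2) + 150 * sqrt \<epsilon> * real k"
    and dense: "real (card (edges G)) \<ge> (1 - \<epsilon>) * real (n choose 2)"
  shows "arrows2 G (path_graph (k + 1)) (path_graph (l + 1))"
  unfolding arrows2_def
proof
  fix c :: "'a set \<Rightarrow> colour"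
  let ?V = "verts G" and ?E = "edges G"
  define P where "P x u v \<longleftrightarrow> {u, v} \<in> ?E \<and> c {u, v} = x" for x u v
  have sym: "symp (P x)" for x by (simp add: symp_def P_def insert_commute)
  have irr: "\<not> P x v v" for x v using not_edge_self[OF G, of v] by (simp add: P_def)
  have col: "c e = Red \<or> c e = Blue" for e by (cases "c e") auto
  have fin: "finite ?V" using G by (simp add: finite_graph_def)
  have n1: "n \<ge> 1"
  proof -
    have "0 \<le> 150 * sqrt \<epsilon> * real k" using eps by simp
    then have "real n \<ge> real k" using large by linarith
    then show ?thesis using kl by simp
  qed
  have dense': "2 * real (card ?E) \<ge> (1 - \<epsilon>) * (real n * (real n - 1))"
    using dense by (simp add: real_choose_two)
  have copy: "contains_copy (colour_class G c x) (path_graph m)"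
    if "\<exists>zs. path_in (P x) ?V zs \<and> length zs = m" for x m
    using that contains_copy_path_graph[of "P x" "colour_class G c x"]
    by (auto simp: colour_class_def P_def)
  have "(\<exists>zs. path_in (P Red) ?V zs \<and> length zs = k + 1) \<or> (\<exists>zs. path_in (P Blue) ?V zs \<and> length zs = l + 1)"
  proof (cases "n > 6 * k")
    case True
    show ?thesis
    proof (rule ccontr)
      assume neg: "\<not> ?thesis"
      let ?E' = "\<lambda>x. {(u, v) \<in> ?V \<times> ?V. P x u v}"
      have bound: "card (?E' x) \<le> 2 * (m - 1) * n"
        if m: "0 < m" "\<not> (\<exists>zs. path_in (P x) ?V zs \<and> length zs = m + 1)" for x m
      proof (rule ccontr)
        assume "\<not> ?thesis"
        then have "2 * (m - 1) * card ?V < card (?E' x)" using n by simp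
        then have "\<exists>zs. path_in (P x) ?V zs \<and> length zs = m - 1 + 2"
          by (rule many_pairs_imp_path[OF fin sym irr])
        then show False using m by simp
      qed
      have un: "{(x, y) \<in> ?V \<times> ?V. {x, y} \<in> ?E} = ?E' Red \<union> ?E' Blue"
        using col by (auto simp: P_def)
      have "2 * card ?E \<le> card (?E' Red) + card (?E' Blue)"
        using card_Un_le[of "?E' Red" "?E' Blue"] card_adjacent_pairs[OF G] unfolding un by linarith
      also have "\<dots> \<le> 2 * (k - 1) * n + 2 * (l - 1) * n"
        using kl neg by (intro add_mono bound) auto
      also have "\<dots> \<le> 2 * (k - 1) * n + 2 * (k - 1) * n"
        using kl by (intro add_mono mult_right_mono mult_left_mono diff_le_mono) auto
      finally have "2 * card ?E \<le> 4 * (k - 1) * n" by simp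
      then have "real (2 * card ?E) \<le> real (4 * (k - 1) * n)" by (rule of_nat_mono)
      then have "2 * real (card ?E) \<le> 4 * (real k - 1) * real n" using kl by (simp add: of_nat_diff)
      \<comment> \<open>At least three quarters of all ordered pairs are adjacent, too many for the
        bound \<open>4 * (k - 1) * n\<close> when \<open>n > 6 * k\<close>.\<close>
      moreover have "3/4 * (real n * (real n - 1)) \<le> (1 - \<epsilon>) * (real n * (real n - 1))"
        using eps n1 by (intro mult_right_mono) auto
      ultimately have "real n * (3/4 * (real n - 1)) \<le> real n * (4 * (real k - 1))"
        using dense' by (simp add: algebra_simps)
      then have "3/4 * (real n - 1) \<le> 4 * (real k - 1)" using n1 by simp
      moreover have "6 * real k < real n" using True by simp
      ultimately show False by simp
    qed
  next
    case False
    define s where "s = sqrt \<epsilon>"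
    have s: "0 \<le> s" "\<epsilon> = s * s" using eps by (auto simp: s_def)
    let ?D = "\<lambda>v. card {w \<in> ?V - {v}. {v, w} \<notin> ?E}"
    \<comment> \<open>The missing degrees sum to at most \<open>(s * n)^2\<close>, so by Markov's
      inequality at most \<open>2 * s * n\<close> vertices exceed this threshold.\<close>
    define W where "W = {v \<in> ?V. real (?D v) > s * real n / 2}"
    have W: "W \<subseteq> ?V" "finite W" using fin by (auto simp: W_def)
    have "real (\<Sum>v\<in>?V. ?D v) + 2 * real (card ?E) = real n * (real n - 1)"
      using sum_missing_degrees[OF G n] n1
      by (metis (no_types, lifting) of_nat_1 of_nat_add of_nat_diff of_nat_mult of_nat_numeral)
    then have miss: "real (\<Sum>v\<in>?V. ?D v) \<le> \<epsilon> * (real n * (real n - 1))"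
      using dense' by (simp add: algebra_simps)
    also have "\<dots> \<le> \<epsilon> * (real n * real n)" using eps by (intro mult_left_mono) auto
    finally have M: "real (\<Sum>v\<in>?V. ?D v) \<le> (s * real n) * (s * real n)" using s by (simp add: algebra_simps)
    have cW: "real (card W) \<le> 2 * s * real n"
    \<comment> \<open>Markov's inequality divides by \<open>s * n\<close>; for \<open>s = 0\<close>
      no pair is missing and \<open>W\<close> is empty.\<close>
    proof (cases "s = 0")
      case True
      then have "real (\<Sum>v\<in>?V. ?D v) \<le> 0" using M by (simp del: of_nat_sum)
      then have "(\<Sum>v\<in>?V. ?D v) = 0" by (simp only: of_nat_le_0_iff)
      then have "?D v = 0" if "v \<in> ?V" for v using fin that by (simp only: sum_eq_0_iff)
      then have "W = {}" by (simp add: W_def True)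
      then show ?thesis using s by simp
    next
      case False
      then have pos: "s * real n > 0" using s n1 by simp
      have "real (card W) * (s * real n / 2) = (\<Sum>v\<in>W. s * real n / 2)" by simp
      also have "\<dots> \<le> (\<Sum>v\<in>W. real (?D v))" by (intro sum_mono) (auto simp: W_def)
      also have "\<dots> \<le> (\<Sum>v\<in>?V. real (?D v))" using W fin by (intro sum_mono2) auto
      also have "\<dots> \<le> (s * real n) * (s * real n)" using M by simp
      finally have "(s * real n) * real (card W) \<le> (s * real n) * (2 * s * real n)" by (simp add: algebra_simps)
      then show ?thesis using pos by (rule mult_left_le_imp_le)
    qed
    define d where "d = nat \<lfloor>s * real n / 2\<rfloor>"
    have d: "real d \<le> s * real n / 2" unfolding d_def using s by (intro of_nat_floor) simp
    have tc: "two_coloured (P Red) (P Blue) (?V - W) d"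
    proof
      fix v assume v: "v \<in> ?V - W"
      have "{w \<in> ?V - W - {v}. \<not> P Red v w \<and> \<not> P Blue v w} \<subseteq> {w \<in> ?V - {v}. {v, w} \<notin> ?E}"
        using col by (auto simp: P_def)
      then have "card {w \<in> ?V - W - {v}. \<not> P Red v w \<and> \<not> P Blue v w} \<le> ?D v"
        using fin by (intro card_mono) auto
      also have "?D v \<le> d" using v unfolding d_def by (intro le_nat_floor) (auto simp: W_def)
      finally show "card {w \<in> ?V - W - {v}. \<not> P Red v w \<and> \<not> P Blue v w} \<le> d" .
    qed (use fin sym irr in auto)
    \<comment> \<open>The cost is \<open>2 * s * n\<close> for \<open>W\<close> and
      \<open>28 * d \<le> 14 * s * n\<close>, together within \<open>25 * s * n\<close>, which
      \<open>n \<le> 6 * k\<close> bounds by \<open>150 * s * k\<close>.\<close>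
    have "s * real n \<le> s * (6 * real k)" using False s by (intro mult_left_mono) auto
    then have "25 * (s * real n) \<le> 150 * s * real k" by simp
    moreover have "card (?V - W) = n - card W" "card W \<le> n"
      using W fin n card_mono by (auto simp: card_Diff_subset)
    ultimately have "real (card (?V - W)) \<ge> real k + real ((l + 1) div 2) + 28 * real d"
      using large cW d s by (simp add: of_nat_diff s_def[symmetric])
    then have "real (card (?V - W)) \<ge> real (k + (l + 1) div 2 + 28 * d)" by simp
    then have "card (?V - W) \<ge> k + (l + 1) div 2 + 28 * d" by (simp only: of_nat_le_iff)
    then have "(\<exists>zs. path_in (P Red) (?V - W) zs \<and> length zs = k + 1) \<or>
        (\<exists>zs. path_in (P Blue) (?V - W) zs \<and> length zs = l + 1)"
      using min_degree_path_ramsey[OF tc] kl by simp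
    then show ?thesis using path_in_mono[of _ "?V - W" _ ?V] by blast
  qed
  then show "contains_copy (colour_class G c Red) (path_graph (k + 1)) \<or>
      contains_copy (colour_class G c Blue) (path_graph (l + 1))"
    using copy by blast
qed

text \<open>The strict bound on \<open>k\<close> covers rounding down and up alike. The previous
  result is applied with both parameters equal to \<open>k - 1\<close>; what needs care is that
  rounding may use up a constant.\<close>

lemma dense_arrows_path:
  assumes eps: "0 \<le> \<epsilon>" "\<epsilon> < 1/90000" and G: "finite_graph G" and n: "card (verts G) = n"
    and dense: "real (card (edges G)) \<ge> (1 - \<epsilon>) * real (n choose 2)"
    and k: "real k < (2/3 - 100 * sqrt \<epsilon>) * real n + 1" and k0: "k = 0 \<or> n > 0"
  shows "arrows G (path_graph k)"
proof (cases "k \<le> 1")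
  case True
  have fin: "finite (verts G)" using G by (simp add: finite_graph_def)
  obtain v where "k = 0 \<or> v \<in> verts G" using k0 n fin by (cases "verts G = {}") auto
  then have "contains_copy (colour_class G c x) (path_graph k)" for c x
    using True unfolding contains_copy_def
    by (intro exI[of _ "\<lambda>_. v"]) (auto simp: path_graph_def colour_class_def inj_on_def)
  then show ?thesis by (simp add: arrows_def arrows2_def)
next
  case False
  define s where "s = sqrt \<epsilon>"
  have s: "0 \<le> s" "\<epsilon> = s * s" using eps by (auto simp: s_def)
  define t where "t = k - 1"
  have t: "k = t + 1" "0 < t" using False by (auto simp: t_def)
  have tn: "real t < (2/3 - 100 * s) * real n" using k t by (simp add: s_def)
  have half: "real ((t + 1) div 2) \<le> (real t + 1) / 2" using of_nat_div_le_of_nat[of "t + 1" 2] by simp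
  \<comment> \<open>For a complete graph \<open>\<delta> = 0\<close> works and integrality absorbs
    the rounding; otherwise \<open>\<delta> = \<epsilon>\<close>.\<close>
  have "\<exists>\<delta>. 0 \<le> \<delta> \<and> \<delta> \<le> 1/4 \<and> real n \<ge> real t + real ((t + 1) div 2) + 150 * sqrt \<delta> * real t \<and>
      real (card (edges G)) \<ge> (1 - \<delta>) * real (n choose 2)"
  proof (cases "card (edges G) \<ge> n choose 2")
    case True
    have "(2/3 - 100 * s) * real n \<le> 2/3 * real n" using s by (intro mult_right_mono) auto
    then have "3 * t < 2 * n" using tn by linarith
    then have "t + (t + 1) div 2 \<le> n" by linarith
    then have "real (t + (t + 1) div 2) \<le> real n" by (simp only: of_nat_le_iff)
    then show ?thesis using True by (intro exI[of _ 0]) auto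
  next
    case False
    \<comment> \<open>A single missing edge already forces \<open>s * n \<ge> 1\<close>. The product
      \<open>(3/2 + 150 * s) * (2/3 - 100 * s)\<close> equals
      \<open>1 - 50 * s - 15000 * s^2\<close>, so at least 50 is left to cover the rounding term
      \<open>1/2\<close>.\<close>
    then have "real (card (edges G)) + 1 \<le> real (n choose 2)" by linarith
    then have "1 \<le> \<epsilon> * real (n choose 2)" using dense by (simp add: algebra_simps)
    also have "\<dots> \<le> \<epsilon> * (real n * real n)"
      using eps by (intro mult_left_mono) (auto simp: real_choose_two algebra_simps)
    also have "\<dots> = (s * real n)\<^sup>2" by (simp add: s power2_eq_square algebra_simps)
    finally have sn: "1 \<le> s * real n" using s
      by (metis mult_nonneg_nonneg of_nat_0_le_iff one_le_power power2_le_imp_le power_one)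
    have "(3/2 + 150 * s) * real t \<le> (3/2 + 150 * s) * ((2/3 - 100 * s) * real n)"
      using tn s by (intro mult_left_mono) auto
    also have "\<dots> = real n - 50 * (s * real n) - 15000 * (s * (s * real n))" by (simp add: algebra_simps)
    also have "\<dots> \<le> real n - 50" using sn s mult_nonneg_nonneg[of s "s * real n"] by linarith
    finally have "real n \<ge> real t + real ((t + 1) div 2) + 150 * s * real t"
      using half by (simp add: algebra_simps)
    then show ?thesis using eps dense by (intro exI[of _ \<epsilon>]) (auto simp: s_def)
  qed
  then obtain \<delta> where "0 \<le> \<delta>" "\<delta> \<le> 1/4" "real n \<ge> real t + real ((t + 1) div 2) + 150 * sqrt \<delta> * real t"
      "real (card (edges G)) \<ge> (1 - \<delta>) * real (n choose 2)" by blast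
  then have "arrows2 G (path_graph (t + 1)) (path_graph (t + 1))"
    using dense_arrows_paths[OF _ _ t(2) order_refl G n] by blast
  then show ?thesis using t(1) by (simp add: arrows_def)
qed

theorem theorem1p2:
  "(\<forall>(\<epsilon>::real) (k::nat) (l::nat) (n::nat) (G::'a graph).
      0 \<le> \<epsilon> \<and> \<epsilon> \<le> 1/4 \<and> 0 < l \<and> l \<le> k \<and>
      finite_graph G \<and> card (verts G) = n \<and>
      real n \<ge> real k + real_of_int \<lfloor>(real l + 1) / 2\<rfloor> + 150 * sqrt \<epsilon> * real k \<and>
      real (card (edges G)) \<ge> (1 - \<epsilon>) * real (n choose 2)
      \<longrightarrow> arrows2 G (path_graph (k + 1)) (path_graph (l + 1)))
   \<and>
   (\<forall>(\<epsilon>::real) (n::nat) (G::'a graph) (k::nat).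
      0 \<le> \<epsilon> \<and> \<epsilon> < 1/90000 \<and>
      finite_graph G \<and> card (verts G) = n \<and>
      real (card (edges G)) \<ge> (1 - \<epsilon>) * real (n choose 2) \<and>
      (int k = \<lfloor>(2/3 - 100 * sqrt \<epsilon>) * real n\<rfloor> \<or> int k = \<lceil>(2/3 - 100 * sqrt \<epsilon>) * real n\<rceil>)
      \<longrightarrow> arrows G (path_graph k))"
proof -
  have half: "real_of_int \<lfloor>(real l + 1) / 2\<rfloor> = real ((l + 1) div 2)" for l
    using floor_divide_of_nat_eq[of "l + 1" 2, where 'a = real] by (simp add: add.commute)
  have round: "real k < y + 1" if "int k = \<lfloor>y\<rfloor> \<or> int k = \<lceil>y\<rceil>" for k and y :: real
    using that by linarith
  have zero: "k = 0 \<or> n > 0" if "int k = \<lfloor>a * real n\<rfloor> \<or> int k = \<lceil>a * real n\<rceil>" for k n and a :: real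
    using that by (cases "n = 0") auto
  show ?thesis
    unfolding half
  proof (intro conjI allI impI)
    fix \<epsilon> :: real and k n and G :: "'a graph"
    assume a: "0 \<le> \<epsilon> \<and> \<epsilon> < 1/90000 \<and> finite_graph G \<and> card (verts G) = n \<and>
      real (card (edges G)) \<ge> (1 - \<epsilon>) * real (n choose 2) \<and>
      (int k = \<lfloor>(2/3 - 100 * sqrt \<epsilon>) * real n\<rfloor> \<or> int k = \<lceil>(2/3 - 100 * sqrt \<epsilon>) * real n\<rceil>)"
    then show "arrows G (path_graph k)"
      by (intro dense_arrows_path[of \<epsilon> G n k] round zero[of k "2/3 - 100 * sqrt \<epsilon>" n]) auto
  qed (use dense_arrows_paths in blast)
qed

end
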